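(* \[ \sum_{k=0}^\infty\frac{1}{\alpha^{2k}}\left(\frac{1}{2k+1}+\frac{3\beta}{2k+2}\right)=0. \]
   Context: $\alpha=(1+\sqrt5)/2$ is the golden ratio and $\beta=-1/\alpha=(1-\sqrt5)/2$. *)

theory Defs
  imports "HOL-Analysis.Analysis"
begin

definition golden_alpha :: real where
  "golden_alpha = (1 + sqrt 5) / 2"

definition golden_beta :: real where
  "golden_beta = - 1 / golden_alpha"

lemma golden_beta_eq: "golden_beta = (1 - sqrt 5) / 2"
proof -
  have "(1 + sqrt 5) * (1 - sqrt 5) = - 4"
    by (simp add: algebra_simps)
  moreover have "1 + sqrt 5 > 0"
    by (simp add: add_pos_nonneg)
  ultimately show ?thesis
    unfolding golden_beta_def golden_alpha_def by (simp add: field_simps)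
qed

end

theory Submission
  imports Defs
begin

text \<open>
  Put $x = 1/\alpha$, so $\beta = -x$. The first half of the series is
  $\mathrm{artanh}(x)/x = \frac{1}{2x}\ln\frac{1+x}{1-x}$ and the second half is
  $\frac{3}{2x}\ln(1 - x^2)$. Since $\frac{1+x}{1-x} = \alpha^3$ and $1 - x^2 = 1/\alpha$,
  these are $\pm\frac{3\alpha}{2}\ln\alpha$ and cancel.
\<close>

lemma golden_alpha_gt_1: "golden_alpha > 1"
  by (simp add: golden_alpha_def)

lemma golden_alpha_square: "golden_alpha\<^sup>2 = golden_alpha + 1"
  by (simp add: golden_alpha_def power2_eq_square field_simps)

lemma sums_odd_reciprocals_golden_alpha:
  "(\<lambda>k. 1 / golden_alpha ^ (2 * k) * (1 / (2 * real k + 1)))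
     sums (3 * golden_alpha / 2 * ln golden_alpha)"
proof -
  let ?a = golden_alpha
  have a: "?a > 1" by (rule golden_alpha_gt_1)
  \<comment> \<open>The series for \<open>ln y\<close> in odd powers of
    \<open>(y - 1) / (y + 1)\<close> is used at \<open>y = ?a ^ 3\<close>. By this identity
    numerator and denominator are \<open>2 * ?a\<close> and
    \<open>2 * (?a + 1) = 2 * ?a\<^sup>2\<close>, so the ratio is \<open>1 / ?a\<close>.\<close>
  have cube: "?a ^ 3 = 2 * ?a + 1"
  proof -
    have "?a ^ 3 = ?a * ?a\<^sup>2" by (simp add: power3_eq_cube power2_eq_square)
    also have "\<dots> = ?a\<^sup>2 + ?a"
      unfolding golden_alpha_square
      by (simp add: distrib_left golden_alpha_square flip: power2_eq_square)
    finally show ?thesis by (simp add: golden_alpha_square)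
  qed
  have "(?a ^ 3 - 1) / (?a ^ 3 + 1) = ?a / ?a\<^sup>2"
    using a unfolding cube golden_alpha_square by (simp add: field_simps)
  then have ratio: "(?a ^ 3 - 1) / (?a ^ 3 + 1) = 1 / ?a"
    using a by (simp add: power2_eq_square)
  have "(\<lambda>k. 2 * (1 / ?a) ^ (2 * k + 1) / of_nat (2 * k + 1)) sums ln (?a ^ 3)"
    using ln_series_quadratic[of "?a ^ 3"] a unfolding ratio by simp
  \<comment> \<open>The factor cancels the 2 in each term and lowers the exponent
    \<open>2 * k + 1\<close> to \<open>2 * k\<close>.\<close>
  from sums_mult[OF this, of "?a / 2"]
  have "(\<lambda>k. ?a / 2 * (2 * (1 / ?a) ^ (2 * k + 1) / of_nat (2 * k + 1)))
          sums (3 * ?a / 2 * ln ?a)"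
    using a by (simp add: ln_realpow mult_ac)
  moreover have "?a / 2 * (2 * (1 / ?a) ^ (2 * k + 1) / of_nat (2 * k + 1))
      = 1 / ?a ^ (2 * k) * (1 / (2 * real k + 1))" for k
    using a by (simp add: power_divide)
  ultimately show ?thesis by simp
qed

lemma sums_even_reciprocals_golden_alpha:
  "(\<lambda>k. 1 / golden_alpha ^ (2 * k) * (3 * golden_beta / (2 * real k + 2)))
     sums (- (3 * golden_alpha / 2 * ln golden_alpha))"
proof -
  let ?a = golden_alpha
  have a: "?a > 1" by (rule golden_alpha_gt_1)
  have "1 + - (1 / ?a\<^sup>2) = (?a\<^sup>2 - 1) / ?a\<^sup>2"
    using a by (simp add: field_simps)
  also have "\<dots> = ?a / ?a\<^sup>2" by (simp add: golden_alpha_square)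
  also have "\<dots> = 1 / ?a" using a by (simp add: power2_eq_square)
  finally have "ln (1 + - (1 / ?a\<^sup>2)) = - ln ?a" using a by (simp add: ln_div)
  moreover have "\<bar>- (1 / ?a\<^sup>2)\<bar> < 1" using a by simp
  ultimately have "(\<lambda>n. - ((1 / ?a\<^sup>2) ^ n / real n)) sums (- ln ?a)"
    using ln_series'[of "- (1 / ?a\<^sup>2)"] by simp
  \<comment> \<open>The index shift keeps the sum: the term at 0 is \<open>1 / 0\<close>, which is 0
    by convention.\<close>
  then have "(\<lambda>k. - ((1 / ?a\<^sup>2) ^ Suc k / real (Suc k))) sums (- ln ?a)"
    by (subst sums_Suc_iff) simp
  \<comment> \<open>Writing \<open>1 / (k + 1)\<close> as \<open>2 / (2 * k + 2)\<close> and
    splitting off \<open>1 / ?a\<^sup>2\<close> leaves the coefficient \<open>- 3 / ?a\<close>,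
    which is \<open>3 * golden_beta\<close>.\<close>
  from sums_mult[OF this, of "3 * ?a / 2"]
  have "(\<lambda>k. 3 * ?a / 2 * - ((1 / ?a\<^sup>2) ^ Suc k / real (Suc k)))
          sums (- (3 * ?a / 2 * ln ?a))"
    by simp
  moreover have "3 * ?a / 2 * - ((1 / ?a\<^sup>2) ^ Suc k / real (Suc k))
      = 1 / ?a ^ (2 * k) * (3 * golden_beta / (2 * real k + 2))" for k
    using a by (simp add: golden_beta_def power_mult power_divide divide_simps)
      (simp add: power2_eq_square algebra_simps)
  ultimately show ?thesis by simp
qed

theorem theorem5p5:
  shows "(\<lambda>k::nat. 1 / golden_alpha ^ (2 * k) *
            (1 / (2 * real k + 1) + 3 * golden_beta / (2 * real k + 2))) sums 0"
  using sums_add[OF sums_odd_reciprocals_golden_alpha sums_even_reciprocals_golden_alpha]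
  by (simp add: distrib_left)

end
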